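(* Consider the following linear network processes (identity activation and output functions), in which the gates are replaced by constant diagonal matrices $D_i,D_f,D_o$, with input $x^{(t)}$ and i.i.d. errors $\varepsilon^{(t)}$: (constant-gates-LSTM) $y^{(t)}=W_{zh}h^{(t)}+\varepsilon^{(t)}$, $\tilde c^{(t)}=W_{ch}h^{(t-1)}+W_{cx}x^{(t)}$, $c^{(t)}=D_i\tilde c^{(t)}+D_fc^{(t-1)}$, $h^{(t)}=D_oc^{(t)}$; (constant-gates-MLSTM) $y^{(t)}=W_{zh}h^{(t)}+\varepsilon^{(t)}$, $\tilde c^{(t)}=W_{ch}h^{(t-1)}+W_{cx}x^{(t)}$, $(I-\mathcal{B})^dc^{(t)}=D_i\tilde c^{(t)}$, $h^{(t)}=D_oc^{(t)}$, with memory parameter $d=(d_1,\dots,d_q)'$, $d_i\in(0,0.5)$. Then, in terms of the definition of long memory network process below, the constant-gates-MLSTM has the capability of handling long-range dependence data (its process can have long memory), while the constant-gates-LSTM cannot.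
   Context: $B$ is the backshift operator, $B^jX_t=X_{t-j}$. For scalar $d$, $(1-B)^d=\sum_{j=0}^\infty w_j(d)B^j$ with $w_j(d)=\prod_{i=0}^{j-1}(i-d)/(i+1)$, asymptotically proportional to $j^{-d-1}$. For a vector $d$, $(I-\mathcal{B})^d=\mathrm{diag}((1-B)^{d_1},\dots,(1-B)^{d_q})$ acting componentwise. A network process of the form $y^{(t)}=\sum_{k=0}^\infty A_kx^{(t-k)}+\varepsilon^{(t)}$ with coefficient matrices $A_k$ and i.i.d. $\varepsilon^{(t)}$ has long memory if there exist indices $i,j$ and $d\in(0,0.5)$ such that $(A_k)_{ij}\sim k^{-d-1}$ as $k\to\infty$ (decay at this polynomial rate). A network has the capability of handling long-range dependence data if its (linearized) network process has long memory in this sense. *)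

theory Defs
  imports "HOL-Analysis.Analysis" "HOL-Library.Landau_Symbols"
begin

text \<open>Coefficients of (1-B)^d:  w_j(d) = prod_{i<j} (i - d)/(i + 1).\<close>
definition frac_coeff :: "real \<Rightarrow> nat \<Rightarrow> real" where
  "frac_coeff d j = (\<Prod>i<j. (real i - d) / (real i + 1))"

definition frac_diff :: "real^'q \<Rightarrow> (int \<Rightarrow> real^'q) \<Rightarrow> int \<Rightarrow> real^'q" where
  "frac_diff d c t = (\<chi> i. (\<Sum>j. frac_coeff (d $ i) j * (c (t - int j) $ i)))"

definition is_diag :: "real^'q^'q \<Rightarrow> bool" where
  "is_diag D \<longleftrightarrow> (\<forall>i j. i \<noteq> j \<longrightarrow> D $ i $ j = 0)"

definition lstm_cg_process ::
  "real^'q^'r \<Rightarrow> real^'q^'q \<Rightarrow> real^'p^'q \<Rightarrow> real^'q^'q \<Rightarrow> real^'q^'q \<Rightarrow> real^'q^'q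
   \<Rightarrow> (nat \<Rightarrow> real^'p^'r) \<Rightarrow> bool" where
  "lstm_cg_process Wzh Wch Wcx Di Df Do A \<longleftrightarrow>
    (\<forall>(x :: int \<Rightarrow> real^'p) (eps :: int \<Rightarrow> real^'r) y ct c h.
      (\<forall>t<0. x t = 0) \<longrightarrow> (\<forall>t<0. c t = 0) \<longrightarrow>
      (\<forall>t. y t = Wzh *v h t + eps t) \<longrightarrow>
      (\<forall>t. ct t = Wch *v h (t - 1) + Wcx *v x t) \<longrightarrow>
      (\<forall>t. c t = Di *v ct t + Df *v c (t - 1)) \<longrightarrow>
      (\<forall>t. h t = Do *v c t) \<longrightarrow>
      (\<forall>t\<ge>0. y t = (\<Sum>k\<le>nat t. A k *v x (t - int k)) + eps t))"

definition mlstm_cg_process ::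
  "real^'q^'r \<Rightarrow> real^'q^'q \<Rightarrow> real^'p^'q \<Rightarrow> real^'q^'q \<Rightarrow> real^'q \<Rightarrow> real^'q^'q
   \<Rightarrow> (nat \<Rightarrow> real^'p^'r) \<Rightarrow> bool" where
  "mlstm_cg_process Wzh Wch Wcx Di d Do A \<longleftrightarrow>
    (\<forall>(x :: int \<Rightarrow> real^'p) (eps :: int \<Rightarrow> real^'r) y ct c h.
      (\<forall>t<0. x t = 0) \<longrightarrow> (\<forall>t<0. c t = 0) \<longrightarrow>
      (\<forall>t. y t = Wzh *v h t + eps t) \<longrightarrow>
      (\<forall>t. ct t = Wch *v h (t - 1) + Wcx *v x t) \<longrightarrow>
      (\<forall>t. frac_diff d c t = Di *v ct t) \<longrightarrow>
      (\<forall>t. h t = Do *v c t) \<longrightarrow>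
      (\<forall>t\<ge>0. y t = (\<Sum>k\<le>nat t. A k *v x (t - int k)) + eps t))"

definition long_memory :: "(nat \<Rightarrow> real^'p^'r) \<Rightarrow> bool" where
  "long_memory A \<longleftrightarrow> (\<exists>i j d C. 0 < d \<and> d < 1/2 \<and> C \<noteq> 0 \<and>
      (\<lambda>k. A k $ i $ j) \<sim>[at_top] (\<lambda>k. C * real k powr (- d - 1)))"

end

theory Submission
  imports Defs "HOL-Real_Asymp.Real_Asymp"
begin

text \<open>
  MLSTM: without recurrence the coefficients of \<open>(1 - B)\<^sup>-\<^sup>d\<close> decay like \<open>k\<^sup>d\<^sup>-\<^sup>1\<close>, too slowly
  for the definition of long memory, so a feedback \<open>Wch = - a I\<close> is used. The transfer function is
  then \<open>1 / ((1 - X)\<^sup>d + a X)\<close>, and the singularity of \<open>(1 - X)\<^sup>d\<close> at 1 yields the rate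
  \<open>k\<^sup>-\<^sup>d\<^sup>-\<^sup>1\<close> provided the denominator has no zeros in the closed unit disc. For \<open>d = 1/3\<close>
  multiplication by a conjugate makes the denominator the polynomial \<open>1 - X + a\<^sup>3 X\<^sup>3\<close>, and for
  a suitable \<open>a\<close> it splits into rational linear factors with roots outside the closed disc; dividing a
  power series by such a factor preserves polynomial decay rates.

  LSTM: each entry of \<open>A\<^sub>k\<close> is a linear functional of an orbit of a linear map, hence satisfies a
  linear recurrence with constant coefficients. If it were asymptotic to \<open>C k\<^sup>-\<^sup>s\<close> with
  \<open>s > 0\<close>, then 1 would be a root of the characteristic polynomial, and removing that root would
  leave a shorter recurrence: the remaining operator maps the sequence to a constant null sequence.
\<close>

section \<open>Power series of fractional differencing\<close>

lemma frac_coeff_gbinomial: "frac_coeff d j = (-1) ^ j * (d gchoose j)"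
proof (induction j)
  case 0
  then show ?case by (simp add: frac_coeff_def)
next
  case (Suc j)
  have "frac_coeff d (Suc j) = frac_coeff d j * ((real j - d) / (real j + 1))"
    by (simp add: frac_coeff_def)
  also have "\<dots> = (-1) ^ Suc j * (d gchoose Suc j)"
    unfolding Suc by (simp add: gbinomial_prod_rev field_simps)
  finally show ?case .
qed

text \<open>The formal power series of (1 - X)^d, so that fractional differencing of a causal
  sequence becomes multiplication.\<close>

definition frac_fps :: "real \<Rightarrow> real fps" where
  "frac_fps d = Abs_fps (frac_coeff d)"

lemma frac_fps_nth [simp]: "fps_nth (frac_fps d) n = frac_coeff d n"
  by (simp add: frac_fps_def)

text \<open>The exponent law for (1 - X)^d, obtained from Vandermonde's convolution once the signs
  (-1)^k and (-1)^(n-k) are merged. It is what turns the cube of the series for 1/3 into a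
  polynomial.\<close>

lemma frac_fps_add: "frac_fps (a + b) = frac_fps a * frac_fps b"
proof (rule fps_ext)
  fix n
  have "fps_nth (frac_fps a * frac_fps b) n
      = (\<Sum>k=0..n. (-1) ^ n * ((a gchoose k) * (b gchoose (n - k))))"
    unfolding fps_mult_nth
    by (intro sum.cong refl)
       (simp add: frac_coeff_gbinomial power_add [symmetric] mult.assoc mult.left_commute)
  also have "\<dots> = fps_nth (frac_fps (a + b)) n"
    by (simp add: sum_distrib_left [symmetric] gbinomial_Vandermonde frac_coeff_gbinomial)
  finally show "fps_nth (frac_fps (a + b)) n = fps_nth (frac_fps a * frac_fps b) n" ..
qed

lemma frac_fps_1: "frac_fps 1 = 1 - fps_X"
proof (rule fps_ext)
  fix n :: nat
  consider "n = 0" | "n = 1" | m where "n = Suc (Suc m)"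
    by (metis One_nat_def not0_implies_Suc)
  then show "fps_nth (frac_fps 1) n = fps_nth (1 - fps_X) n"
  proof cases
    \<comment> \<open>The factor with index 1 in the product is zero.\<close>
    case 3
    then show ?thesis
      by (auto simp: frac_coeff_def fps_X_def intro!: exI[of _ "Suc 0"])
  qed (auto simp: frac_coeff_def fps_X_def)
qed

text \<open>The limit is nonzero unless \<open>d\<close> is an integer, which makes the rate
  n^(-d-1) sharp for fractional \<open>d\<close>.\<close>

lemma frac_coeff_asymp:
  assumes "d > 0"
  shows "(\<lambda>n. frac_coeff d n * real n powr (d + 1)) \<longlonglongrightarrow> inverse (Gamma (- d))"
proof (rule Lim_transform_eventually[OF gbinomial_asymptotic])
  show "\<forall>\<^sub>F n in sequentially.
      (d gchoose n) / ((-1) ^ n / exp ((d + 1) * of_real (ln (real n))))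
      = frac_coeff d n * real n powr (d + 1)"
    using eventually_gt_at_top[of 0]
  proof eventually_elim
    case (elim n)
    have "(-1::real) ^ n = 1 \<or> (-1::real) ^ n = -1"
      by (cases "even n") auto
    with elim show ?case
      by (auto simp: frac_coeff_gbinomial powr_def)
  qed
qed

section \<open>Decay rates under division by a linear factor\<close>

text \<open>Eventually the factors are below some \<theta> < 1 in absolute value, so the initial
  error is damped geometrically and only the small perturbations remain.\<close>

lemma tendsto_zero_perturbed_contraction:
  fixes e :: "nat \<Rightarrow> real"
  assumes rec: "\<And>n. n \<ge> N \<Longrightarrow> e (Suc n) = \<rho> n * e n + \<delta> n"
    and \<rho>: "\<rho> \<longlonglongrightarrow> r" "\<bar>r\<bar> < 1" and \<delta>: "\<delta> \<longlonglongrightarrow> 0"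
  shows "e \<longlonglongrightarrow> 0"
proof (rule LIMSEQ_I)
  fix \<epsilon> :: real assume \<epsilon>: "\<epsilon> > 0"
  obtain \<theta> where \<theta>: "\<bar>r\<bar> < \<theta>" "\<theta> < 1"
    using \<rho>(2) dense by blast
  have "\<forall>\<^sub>F n in sequentially. \<bar>\<rho> n\<bar> < \<theta>"
    using order_tendstoD(2)[OF tendsto_rabs[OF \<rho>(1)] \<theta>(1)] .
  \<comment> \<open>With this threshold, \<epsilon>/2 is the fixed point of the bound z -> \<theta>
    z + (1 - \<theta>) \<epsilon>/2 used in the induction.\<close>
  moreover have "\<forall>\<^sub>F n in sequentially. \<bar>\<delta> n\<bar> < (1 - \<theta>) * (\<epsilon> / 2)"
    using order_tendstoD(2)[OF tendsto_rabs[OF \<delta>], of "(1 - \<theta>) * (\<epsilon> / 2)"] \<theta> \<epsilon> by simp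
  ultimately have "\<forall>\<^sub>F n in sequentially. n \<ge> N \<and> \<bar>\<rho> n\<bar> < \<theta> \<and> \<bar>\<delta> n\<bar> < (1 - \<theta>) * (\<epsilon> / 2)"
    using eventually_ge_at_top[of N] by eventually_elim auto
  then obtain M where M: "\<And>n. n \<ge> M \<Longrightarrow>
      n \<ge> N \<and> \<bar>\<rho> n\<bar> < \<theta> \<and> \<bar>\<delta> n\<bar> < (1 - \<theta>) * (\<epsilon> / 2)"
    by (auto simp: eventually_sequentially)
  have bound: "\<bar>e (M + k)\<bar> \<le> \<epsilon> / 2 + \<theta> ^ k * \<bar>e M\<bar>" for k
  proof (induction k)
    case 0
    then show ?case using \<epsilon> by simp
  next
    case (Suc k)
    have "\<bar>e (M + Suc k)\<bar> \<le> \<bar>\<rho> (M + k)\<bar> * \<bar>e (M + k)\<bar> + \<bar>\<delta> (M + k)\<bar>"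
      using rec[of "M + k"] M[of "M + k"] abs_triangle_ineq[of "\<rho> (M+k) * e (M+k)"]
      by (simp add: abs_mult)
    also have "\<dots> \<le> \<theta> * (\<epsilon> / 2 + \<theta> ^ k * \<bar>e M\<bar>) + (1 - \<theta>) * (\<epsilon> / 2)"
      using M[of "M + k"] Suc \<theta> by (intro add_mono mult_mono) auto
    also have "\<dots> = \<epsilon> / 2 + \<theta> ^ Suc k * \<bar>e M\<bar>"
      by (simp add: field_simps)
    finally show ?case .
  qed
  have "(\<lambda>k. \<epsilon> / 2 + \<theta> ^ k * \<bar>e M\<bar>) \<longlonglongrightarrow> \<epsilon> / 2 + 0 * \<bar>e M\<bar>"
    using \<theta> by (intro tendsto_intros LIMSEQ_power_zero) auto
  then have "\<forall>\<^sub>F k in sequentially. \<epsilon> / 2 + \<theta> ^ k * \<bar>e M\<bar> < \<epsilon>"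
    by (rule order_tendstoD(2)) (use \<epsilon> in simp)
  then obtain K where K: "\<And>k. k \<ge> K \<Longrightarrow> \<epsilon> / 2 + \<theta> ^ k * \<bar>e M\<bar> < \<epsilon>"
    by (auto simp: eventually_sequentially)
  show "\<exists>no. \<forall>n\<ge>no. norm (e n - 0) < \<epsilon>"
  proof (intro exI[of _ "M + K"] allI impI)
    fix n assume "M + K \<le> n"
    then have "\<bar>e (M + (n - M))\<bar> < \<epsilon>"
      using bound[of "n - M"] K[of "n - M"] by linarith
    with \<open>M + K \<le> n\<close> show "norm (e n - 0) < \<epsilon>" by simp
  qed
qed

text \<open>Dividing by 1 - r X gives the recursion u(n+1) = r u(n) + b(n+1). After scaling by n^s
  its limit K must satisfy K = r K + L; the deviation from K obeys a perturbed contraction.\<close>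

lemma fps_divide_linear_asymp:
  fixes U :: "real fps"
  assumes lim: "(\<lambda>n. fps_nth (U * (1 - fps_const r * fps_X)) n * real n powr s) \<longlonglongrightarrow> L"
    and r: "\<bar>r\<bar> < 1"
  shows "(\<lambda>n. fps_nth U n * real n powr s) \<longlonglongrightarrow> L / (1 - r)"
proof -
  define b where "b = fps_nth (U * (1 - fps_const r * fps_X))"
  define v where "v n = fps_nth U n * real n powr s" for n
  define \<rho> where "\<rho> n = r * (real (Suc n) powr s / real n powr s)" for n
  define K where "K = L / (1 - r)"
  define \<delta> where "\<delta> n = b (Suc n) * real (Suc n) powr s - K + \<rho> n * K" for n
  have U_Suc: "fps_nth U (Suc n) = r * fps_nth U n + b (Suc n)" for n
  proof -
    have "U * (1 - fps_const r * fps_X) = U - fps_const r * (U * fps_X)"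
      by (simp add: algebra_simps)
    then show ?thesis by (simp add: b_def)
  qed
  have "(\<lambda>n. real (Suc n) powr s / real n powr s) \<longlonglongrightarrow> 1"
    by real_asymp
  then have \<rho>: "\<rho> \<longlonglongrightarrow> r"
    unfolding \<rho>_def using tendsto_mult[OF tendsto_const[of r]] by fastforce
  have "\<delta> \<longlonglongrightarrow> L - K + r * K"
    unfolding \<delta>_def using LIMSEQ_Suc[OF lim] \<rho> by (intro tendsto_intros) (simp_all add: b_def)
  moreover have "L - K + r * K = 0"
    using r by (simp add: K_def field_simps)
  ultimately have \<delta>: "\<delta> \<longlonglongrightarrow> 0" by simp
  have "(\<lambda>n. v n - K) \<longlonglongrightarrow> 0"
  proof (rule tendsto_zero_perturbed_contraction[OF _ \<rho> r \<delta>])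
    \<comment> \<open>Index 0 is excluded because \<open>real 0 powr s\<close> is 0, so
      \<open>v 0\<close> carries no information about the coefficient.\<close>
    fix n :: nat assume "n \<ge> 1"
    then have "\<rho> n * v n = r * fps_nth U n * real (Suc n) powr s"
      by (simp add: \<rho>_def v_def)
    moreover have "v (Suc n) = r * fps_nth U n * real (Suc n) powr s + b (Suc n) * real (Suc n) powr s"
      by (simp only: v_def U_Suc distrib_right)
    ultimately show "v (Suc n) - K = \<rho> n * (v n - K) + \<delta> n"
      by (simp add: \<delta>_def right_diff_distrib)
  qed
  then show ?thesis
    unfolding v_def K_def by (simp add: LIM_zero_iff)
qed

section \<open>The transfer function of the MLSTM with feedback\<close>

text \<open>The constant solves \<open>a\<^sup>3 = 4/27\<close>, the value for which
  \<open>1 - X + a\<^sup>3 X\<^sup>3 = (1 - 2X/3)\<^sup>2 (1 + X/3)\<close>.\<close>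

definition feedback :: real where
  "feedback = (4 / 27) powr (1 / 3)"

lemma feedback_pos: "feedback > 0"
  by (simp add: feedback_def)

lemma feedback_cubed: "feedback ^ 3 = 4 / 27"
  by (simp add: feedback_def powr_power)

definition transfer_denom :: "real fps" where
  "transfer_denom = frac_fps (1 / 3) + fps_const feedback * fps_X"

lemma transfer_denom_nz: "fps_nth transfer_denom 0 \<noteq> 0"
  by (simp add: transfer_denom_def frac_coeff_def)

text \<open>This is (W + g)(W^2 - W g + g^2) = W^3 + g^3 with W = (1 - X)^(1/3) and g = a X. The
  resulting polynomial has the double root 3/2 and the root -3.\<close>

lemma transfer_denom_conj:
  defines "G \<equiv> frac_fps (2 / 3) - fps_const feedback * fps_X * frac_fps (1 / 3)
                + fps_const (feedback\<^sup>2) * fps_X\<^sup>2"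
  shows "transfer_denom * G
       = (1 - fps_const (2/3) * fps_X) * (1 - fps_const (2/3) * fps_X)
         * (1 - fps_const (- 1/3) * fps_X)"
proof -
  define W where "W = frac_fps (1 / 3)"
  define g where "g = fps_const feedback * fps_X"
  define c :: "real fps" where "c = fps_const (1/3)"
  have W2: "frac_fps (2 / 3) = W * W"
    using frac_fps_add[of "1/3" "1/3"] by (simp add: W_def)
  have W3: "W * W * W = 1 - fps_X"
    using frac_fps_add[of "2/3" "1/3"] by (simp add: W2 frac_fps_1 flip: W_def)
  have g3: "g ^ 3 = fps_const (4 / 27) * fps_X ^ 3"
    by (simp add: g_def power_mult_distrib fps_const_power feedback_cubed)
  have "transfer_denom * G = (W + g) * (W * W - g * W + g\<^sup>2)"
    by (simp add: transfer_denom_def G_def W2 power_mult_distrib fps_const_power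
        flip: W_def g_def)
       (simp add: g_def power_mult_distrib fps_const_power)
  also have "\<dots> = W * W * W + g ^ 3"
    by (simp add: algebra_simps power2_eq_square power3_eq_cube)
  also have "\<dots> = 1 - fps_X + fps_const (4 / 27) * fps_X ^ 3"
    by (simp add: W3 g3)
  also have "\<dots> = (1 - fps_const (2/3) * fps_X) * (1 - fps_const (2/3) * fps_X)
         * (1 - fps_const (- 1/3) * fps_X)"
  proof -
    \<comment> \<open>Writing all constants through \<open>c\<close> reduces the factorization to a
      polynomial identity modulo 3 c = 1.\<close>
    have c: "3 * c = 1"
      by (rule fps_ext) (simp add: c_def numeral_fps_const)
    have "fps_const (4 / 27) = 4 * c ^ 3" "fps_const (2/3) = 2 * c" "fps_const (- 1/3) = - c"
      by (simp_all add: c_def fps_const_power numeral_fps_const power3_eq_cube)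
    then show ?thesis
      using c by algebra
  qed
  finally show ?thesis .
qed

text \<open>The inverse is the conjugate \<open>G\<close> divided by three linear factors, so the
  rate is read off from \<open>G\<close>. There the term a X (1 - X)^(1/3) of order n^(-4/3)
  dominates (1 - X)^(2/3), which has order n^(-5/3).\<close>

lemma inverse_transfer_denom_asymp:
  obtains K where "K \<noteq> 0"
    "(\<lambda>n. fps_nth (inverse transfer_denom) n * real n powr (4 / 3)) \<longlonglongrightarrow> K"
proof -
  define G where "G = frac_fps (2 / 3) - fps_const feedback * fps_X * frac_fps (1 / 3)
                + fps_const (feedback\<^sup>2) * fps_X\<^sup>2"
  define U where "U = inverse transfer_denom"
  define L where "L = inverse (Gamma (- (1 / 3 :: real)))"
  \<comment> \<open>Gamma has no pole at -1/3, hence \<open>L\<close> is nonzero.\<close>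
  have "- (1 / 3 :: real) \<notin> \<int>\<^sub>\<le>\<^sub>0"
  proof
    assume "- (1 / 3 :: real) \<in> \<int>\<^sub>\<le>\<^sub>0"
    then obtain n where "- (1 / 3 :: real) = - real n" by (elim nonpos_Ints_cases') auto
    then have "3 * n = 1" by linarith
    then show False by presburger
  qed
  then have L: "L \<noteq> 0" by (simp add: L_def Gamma_eq_zero_iff)
  have w1: "(\<lambda>n. frac_coeff (1/3) n * real n powr (4/3)) \<longlonglongrightarrow> L"
    using frac_coeff_asymp[of "1/3"] by (simp add: L_def)
  have "(\<lambda>n. (frac_coeff (2/3) n * real n powr (5/3)) * real n powr (- (1/3)))
      \<longlonglongrightarrow> inverse (Gamma (- (2 / 3))) * 0"
    by (intro tendsto_mult) (use frac_coeff_asymp[of "2/3"] in simp, real_asymp)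
  then have w2: "(\<lambda>n. frac_coeff (2/3) n * real n powr (4/3)) \<longlonglongrightarrow> 0"
    by (simp add: mult.assoc powr_add [symmetric])
  have w1_shift: "(\<lambda>n. frac_coeff (1/3) n * real (Suc n) powr (4/3)) \<longlonglongrightarrow> L * 1"
  proof (rule Lim_transform_eventually)
    show "(\<lambda>n. (frac_coeff (1/3) n * real n powr (4/3)) * (real (Suc n) powr (4/3) / real n powr (4/3)))
        \<longlonglongrightarrow> L * 1"
      by (intro tendsto_mult w1) real_asymp
    show "\<forall>\<^sub>F n in sequentially. (frac_coeff (1/3) n * real n powr (4/3))
        * (real (Suc n) powr (4/3) / real n powr (4/3)) = frac_coeff (1/3) n * real (Suc n) powr (4/3)"
      using eventually_gt_at_top[of 0] by eventually_elim simp
  qed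
  have "(\<lambda>n. frac_coeff (2/3) (Suc n) * real (Suc n) powr (4/3)
       - feedback * (frac_coeff (1/3) n * real (Suc n) powr (4/3))) \<longlonglongrightarrow> 0 - feedback * (L * 1)"
    by (rule tendsto_diff[OF LIMSEQ_Suc[OF w2] tendsto_mult[OF tendsto_const w1_shift]])
  moreover have "\<forall>\<^sub>F n in sequentially. frac_coeff (2/3) (Suc n) * real (Suc n) powr (4/3)
       - feedback * (frac_coeff (1/3) n * real (Suc n) powr (4/3))
       = fps_nth G (Suc n) * real (Suc n) powr (4/3)"
    \<comment> \<open>Beyond index 2 the X^2 term of \<open>G\<close> contributes nothing.\<close>
    using eventually_gt_at_top[of 1]
  proof eventually_elim
    case (elim n)
    have "fps_nth G (Suc n) = frac_coeff (2/3) (Suc n) - feedback * frac_coeff (1/3) n"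
      using elim by (simp add: G_def mult.assoc)
    then show ?case by (simp only: left_diff_distrib mult.assoc)
  qed
  ultimately have "(\<lambda>n. fps_nth G (Suc n) * real (Suc n) powr (4/3)) \<longlonglongrightarrow> - feedback * L"
    by (simp add: Lim_transform_eventually)
  then have G: "(\<lambda>n. fps_nth G n * real n powr (4/3)) \<longlonglongrightarrow> - feedback * L"
    by (rule LIMSEQ_imp_Suc)
  have "U * transfer_denom = 1"
    unfolding U_def using transfer_denom_nz by (rule inverse_mult_eq_1)
  then have "G = U * (transfer_denom * G)"
    by (simp add: mult.assoc [symmetric])
  also have "\<dots> = U * (1 - fps_const (2/3) * fps_X) * (1 - fps_const (2/3) * fps_X)
         * (1 - fps_const (- 1/3) * fps_X)"
    unfolding G_def transfer_denom_conj by (simp only: mult.assoc)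
  \<comment> \<open>Each of the three factors 1 - r X divides the limit by 1 - r, with r = -1/3,
    2/3, 2/3.\<close>
  finally have "(\<lambda>n. fps_nth U n * real n powr (4/3))
      \<longlonglongrightarrow> - feedback * L / (1 - (- 1/3)) / (1 - 2/3) / (1 - 2/3)"
    by (intro fps_divide_linear_asymp) (use G in simp_all)
  then show thesis
    using that[of "- feedback * L / (1 - (- 1/3)) / (1 - 2/3) / (1 - 2/3)"] L feedback_pos
    by (simp add: U_def)
qed

section \<open>Realizing the transfer function by an MLSTM process\<close>

text \<open>Vanishing at negative times truncates the infinite sum to a Cauchy product.\<close>

lemma frac_diff_causal:
  assumes "\<And>t. t < 0 \<Longrightarrow> c t = 0"
  shows "frac_diff d c (int n) $ i
       = fps_nth (frac_fps (d $ i) * Abs_fps (\<lambda>n. c (int n) $ i)) n"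
proof -
  have "(\<Sum>j. frac_coeff (d $ i) j * c (int n - int j) $ i)
      = (\<Sum>j\<in>{0..n}. frac_coeff (d $ i) j * c (int n - int j) $ i)"
    using assms by (intro suminf_finite) auto
  also have "\<dots> = (\<Sum>j=0..n. frac_coeff (d $ i) j * c (int (n - j)) $ i)"
    by (intro sum.cong) (auto simp: of_nat_diff)
  finally show ?thesis
    by (simp add: frac_diff_def fps_mult_nth)
qed

text \<open>With all-ones \<open>Wcx\<close> every hidden unit obeys the same scalar equation,
  driven by the sum of the input components. The all-ones \<open>Wzh\<close> adds these equal
  states, whence the factor \<open>CARD('q)\<close>.\<close>

lemma mlstm_long_memory_process:
  defines "A \<equiv> \<lambda>k. (\<chi> i j. real CARD('q) * fps_nth (inverse transfer_denom) k) :: real^'p^'r"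
  shows "mlstm_cg_process (\<chi> i j. 1 :: real^'q^'r) (mat (- feedback)) (\<chi> i j. 1)
           (mat 1) (\<chi> i. 1 / 3) (mat 1) A"
  unfolding mlstm_cg_process_def
proof (intro allI impI)
  fix x :: "int \<Rightarrow> real^'p" and eps :: "int \<Rightarrow> real^'r" and y ct c h t
  assume x0: "\<forall>t<0. x t = 0" and c0: "\<forall>t<0. c t = (0 :: real^'q)"
    and y: "\<forall>t. y t = (\<chi> i j. 1) *v h t + eps t"
    and ct: "\<forall>t. ct t = mat (- feedback) *v h (t - 1) + (\<chi> i j. 1) *v x t"
    and fd: "\<forall>t. frac_diff (\<chi> i. 1 / 3) c t = mat 1 *v ct t"
    and h: "\<forall>t. h t = mat 1 *v c t"
    and t: "(0::int) \<le> t"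
  define S where "S = Abs_fps (\<lambda>n. \<Sum>j\<in>UNIV. x (int n) $ j)"
  have mat_mv: "(mat (- feedback) *v v) $ i = - feedback * v $ i" for v :: "real^'q" and i
    by (simp add: matrix_vector_mult_def mat_def if_distrib if_distribR cong: if_cong)
  have c_fps: "Abs_fps (\<lambda>n. c (int n) $ i) = inverse transfer_denom * S" for i
  proof -
    define C where "C = Abs_fps (\<lambda>n. c (int n) $ i)"
    have "transfer_denom * C = S"
    proof (rule fps_ext)
      fix n
      have "fps_nth (frac_fps (1/3) * C) n = frac_diff (\<chi> i. 1 / 3) c (int n) $ i"
        using c0 by (simp add: frac_diff_causal C_def)
      also have "\<dots> = - feedback * c (int n - 1) $ i + fps_nth S n"
        using fd ct h by (simp add: mat_mv S_def) (simp add: matrix_vector_mult_def)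
      \<comment> \<open>At n = 0 the zero state at time -1 matches the zero constant coefficient of
        \<open>fps_X * C\<close>.\<close>
      also have "c (int n - 1) $ i = fps_nth (fps_X * C) n"
        using c0 by (cases n) (simp_all add: C_def)
      finally show "fps_nth (transfer_denom * C) n = fps_nth S n"
        by (simp add: transfer_denom_def distrib_right mult.assoc)
    qed
    then have "inverse transfer_denom * transfer_denom * C = inverse transfer_denom * S"
      by (simp add: mult.assoc)
    then show ?thesis
      using inverse_mult_eq_1[OF transfer_denom_nz] by (simp add: C_def)
  qed
  show "y t = (\<Sum>k\<le>nat t. A k *v x (t - int k)) + eps t"
  proof (subst vec_eq_iff, rule allI)
    fix i
    have ci: "c t $ j = (\<Sum>k\<le>nat t. fps_nth (inverse transfer_denom) k *
        (\<Sum>l\<in>UNIV. x (t - int k) $ l))" for j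
    proof -
      have "c t $ j = fps_nth (Abs_fps (\<lambda>n. c (int n) $ j)) (nat t)"
        using t by simp
      also have "\<dots> = (\<Sum>k=0..nat t. fps_nth (inverse transfer_denom) k *
          (\<Sum>l\<in>UNIV. x (int (nat t - k)) $ l))"
        unfolding c_fps fps_mult_nth by (simp add: S_def)
      also have "\<dots> = (\<Sum>k\<le>nat t. fps_nth (inverse transfer_denom) k *
          (\<Sum>l\<in>UNIV. x (t - int k) $ l))"
        using t by (intro sum.cong) (auto simp: of_nat_diff)
      finally show ?thesis .
    qed
    have "y t $ i = (\<Sum>j\<in>UNIV. c t $ j) + eps t $ i"
    proof -
      have "h t = c t" using h by simp
      then show ?thesis using y by (simp add: matrix_vector_mult_def)
    qed
    then show "y t $ i = ((\<Sum>k\<le>nat t. A k *v x (t - int k)) + eps t) $ i"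
      by (simp add: ci A_def matrix_vector_mult_def sum_distrib_left mult.assoc)
  qed
qed

lemma long_memoryI:
  assumes "(\<lambda>n. A n $ i $ j * real n powr (d + 1)) \<longlonglongrightarrow> C" "C \<noteq> 0" "0 < d" "d < 1/2"
  shows "long_memory A"
  unfolding long_memory_def
proof (intro exI conjI)
  have "(\<lambda>n. A n $ i $ j * real n powr (d + 1) / C) \<longlonglongrightarrow> C / C"
    by (intro tendsto_divide assms tendsto_const)
  then have "(\<lambda>n. A n $ i $ j * real n powr (d + 1) / C) \<longlonglongrightarrow> 1"
    using assms by simp
  moreover have "- d - 1 = - (d + 1)" by simp
  ultimately show "(\<lambda>k. A k $ i $ j) \<sim>[at_top] (\<lambda>k. C * real k powr (- d - 1))"
    by (intro asymp_equivI') (simp only: powr_minus, simp add: field_simps)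
qed (use assms in auto)

section \<open>Linear recurrences exclude power-law decay\<close>

text \<open>The polynomial \<open>P\<close> in the forward shift operator, applied to the sequence
  \<open>a\<close>.\<close>

definition recur :: "real poly \<Rightarrow> (nat \<Rightarrow> real) \<Rightarrow> nat \<Rightarrow> real" where
  "recur P a k = (\<Sum>i\<le>degree P. coeff P i * a (k + i))"

lemma recur_superset:
  assumes "degree P \<le> n"
  shows "recur P a k = (\<Sum>i\<le>n. coeff P i * a (k + i))"
  unfolding recur_def using assms
  by (intro sum.mono_neutral_left) (auto simp: coeff_eq_0)

text \<open>The factor X - 1 acts as the forward difference.\<close>

lemma recur_mult_linear:
  "recur ([:-1, 1:] * Q) a k = recur Q a (Suc k) - recur Q a k"
proof -
  define n where "n = degree Q"
  have deg: "degree ([:-1, 1:] * Q) \<le> Suc n"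
    by (rule order.trans[OF degree_mult_le]) (simp add: n_def)
  have "recur ([:-1, 1:] * Q) a k
      = (\<Sum>i\<le>Suc n. coeff (pCons 0 Q) i * a (k + i)) - (\<Sum>i\<le>Suc n. coeff Q i * a (k + i))"
    unfolding recur_superset[OF deg]
    by (simp add: left_diff_distrib sum_subtractf del: sum.atMost_Suc)
  also have "(\<Sum>i\<le>Suc n. coeff (pCons 0 Q) i * a (k + i)) = recur Q a (Suc k)"
    by (subst sum.atMost_Suc_shift) (simp add: recur_def n_def)
  also have "(\<Sum>i\<le>Suc n. coeff Q i * a (k + i)) = recur Q a k"
    by (rule recur_superset [symmetric]) (simp add: n_def)
  finally show ?thesis .
qed

text \<open>After scaling by k^s every shift of \<open>a\<close> has the same limit
  \<open>C\<close>, so the recurrence forces P(1) C = 0. Splitting off X - 1 leads to a nonzero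
  annihilator of smaller degree, an infinite descent.\<close>

lemma recurrent_not_powr_decay:
  assumes "\<And>k. recur P a k = 0" "P \<noteq> 0" "s > 0" "C \<noteq> 0"
  shows "\<not> (\<lambda>k. a k * real k powr s) \<longlonglongrightarrow> C"
proof
  assume lim: "(\<lambda>k. a k * real k powr s) \<longlonglongrightarrow> C"
  have shift: "(\<lambda>k. a (k + i) * real k powr s) \<longlonglongrightarrow> C" for i
  proof -
    have "(\<lambda>k. (a (k + i) * real (k + i) powr s) * (real k powr s / real (k + i) powr s)) \<longlonglongrightarrow> C * 1"
      by (intro tendsto_mult LIMSEQ_ignore_initial_segment[OF lim]) real_asymp
    moreover have "\<forall>\<^sub>F k in sequentially. (a (k + i) * real (k + i) powr s)
        * (real k powr s / real (k + i) powr s) = a (k + i) * real k powr s"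
      using eventually_gt_at_top[of 0] by eventually_elim simp
    ultimately show ?thesis by (simp add: Lim_transform_eventually)
  qed
  have recur_lim: "(\<lambda>k. recur Q a k * real k powr s) \<longlonglongrightarrow> poly Q 1 * C" for Q
  proof -
    have "(\<lambda>k. \<Sum>i\<le>degree Q. coeff Q i * (a (k + i) * real k powr s))
        \<longlonglongrightarrow> (\<Sum>i\<le>degree Q. coeff Q i * C)"
      by (intro tendsto_sum tendsto_mult tendsto_const shift)
    then show ?thesis
      by (simp add: recur_def poly_altdef sum_distrib_right mult.assoc)
  qed
  show False
    using assms(1,2)
  proof (induction "degree P" arbitrary: P rule: less_induct)
    case less
    have "(\<lambda>k. 0) \<longlonglongrightarrow> poly P 1 * C"
      using recur_lim[of P] less.prems by simp
    then have "poly P 1 = 0"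
      using assms(4) LIMSEQ_unique tendsto_const by fastforce
    then obtain Q where Q: "P = [:-1, 1:] * Q"
      by (auto simp: poly_eq_0_iff_dvd)
    with less.prems have "Q \<noteq> 0" by auto
    then have deg: "degree Q < degree P"
      unfolding Q by (subst degree_mult_eq) auto
    have const: "recur Q a k = recur Q a 0" for k
      using less.prems(1) unfolding Q recur_mult_linear by (induction k) simp_all
    \<comment> \<open>Undoing the scaling with k^(-s) -> 0 shows that the constant value is
      0.\<close>
    have "(\<lambda>k. recur Q a k * real k powr s * real k powr (-s)) \<longlonglongrightarrow> poly Q 1 * C * 0"
      using \<open>s > 0\<close> by (intro tendsto_mult recur_lim) real_asymp
    moreover have "\<forall>\<^sub>F k in sequentially. recur Q a k * real k powr s * real k powr (-s) = recur Q a 0"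
      using eventually_gt_at_top[of 0]
    proof eventually_elim
      case (elim k)
      then show ?case using const[of k] by (simp add: mult.assoc flip: powr_add)
    qed
    ultimately have "(\<lambda>k. recur Q a 0) \<longlonglongrightarrow> 0"
      by (simp add: Lim_transform_eventually)
    then have "recur Q a 0 = 0"
      using LIMSEQ_unique tendsto_const by blast
    then show False
      using less.hyps[OF deg] const \<open>Q \<noteq> 0\<close> by auto
  qed
qed

section \<open>Orbits of linear maps satisfy recurrences\<close>

text \<open>The first \<open>DIM('a) + 1\<close> terms are linearly dependent; the coefficients of
  the relation are packed into a polynomial.\<close>

lemma euclidean_sequence_dependent:
  fixes f :: "nat \<Rightarrow> 'a :: euclidean_space"
  obtains P :: "real poly" where "P \<noteq> 0" "(\<Sum>i\<le>degree P. coeff P i *\<^sub>R f i) = 0"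
proof -
  let ?I = "{..DIM('a)}"
  have "\<exists>P. P \<noteq> 0 \<and> degree P \<le> DIM('a) \<and> (\<Sum>i\<in>?I. coeff P i *\<^sub>R f i) = 0"
  proof (cases "inj_on f ?I")
    case False
    \<comment> \<open>Dependence is a property of sets and does not see repetitions, so a repeated
      term gets its own relation X^i - X^j.\<close>
    then obtain i j where ij: "i \<in> ?I" "j \<in> ?I" "i \<noteq> j" "f i = f j"
      by (auto simp: inj_on_def)
    let ?P = "monom 1 i - monom (1::real) j"
    have "coeff ?P i \<noteq> 0" using ij by simp
    then have "?P \<noteq> 0" by force
    moreover have "degree ?P \<le> DIM('a)"
      using ij by (intro degree_diff_le) (auto simp: degree_monom_eq)
    moreover have "(\<Sum>l\<in>?I. coeff ?P l *\<^sub>R f l) = 0"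
    proof -
      have "(\<Sum>l\<in>?I. coeff (monom (1::real) m) l *\<^sub>R f l) = f m" if "m \<in> ?I" for m
      proof -
        have "(\<Sum>l\<in>?I. coeff (monom (1::real) m) l *\<^sub>R f l) = (\<Sum>l\<in>?I. if l = m then f l else 0)"
          by (intro sum.cong) auto
        also have "\<dots> = f m" using that by simp
        finally show ?thesis .
      qed
      with ij show ?thesis by (simp only: coeff_diff scaleR_diff_left sum_subtractf) simp
    qed
    ultimately show ?thesis by blast
  next
    case True
    then have "card (f ` ?I) > DIM('a)" by (simp add: card_image)
    then have "dependent (f ` ?I)"
      using independent_card_le by fastforce
    then obtain u where u: "\<exists>v\<in>f ` ?I. u v \<noteq> 0" "(\<Sum>v\<in>f ` ?I. u v *\<^sub>R v) = 0"
      using dependent_finite[of "f ` ?I"] by blast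
    define P where "P = (\<Sum>i\<in>?I. monom (u (f i)) i)"
    have P: "coeff P i = u (f i)" if "i \<in> ?I" for i
      using that by (simp add: P_def coeff_sum)
    then have "P \<noteq> 0" using u(1) by force
    moreover have "degree P \<le> DIM('a)"
      unfolding P_def by (intro degree_sum_le) (auto intro: order.trans[OF degree_monom_le])
    moreover have "(\<Sum>i\<in>?I. coeff P i *\<^sub>R f i) = 0"
      using u(2) True P by (simp add: sum.reindex)
    ultimately show ?thesis by blast
  qed
  then obtain P where P: "P \<noteq> 0" "degree P \<le> DIM('a)" "(\<Sum>i\<in>?I. coeff P i *\<^sub>R f i) = 0"
    by blast
  have "(\<Sum>i\<le>degree P. coeff P i *\<^sub>R f i) = (\<Sum>i\<in>?I. coeff P i *\<^sub>R f i)"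
    using P(2) by (intro sum.mono_neutral_left) (auto simp: coeff_eq_0)
  with P that show thesis by metis
qed

text \<open>One relation among the iterates of \<open>v\<close> is carried to every starting index
  \<open>k\<close> by the linear functional \<phi> composed with the k-th power of
  \<open>T\<close>.\<close>

lemma linear_orbit_recurrent:
  fixes T :: "'a :: euclidean_space \<Rightarrow> 'a" and \<phi> :: "'a \<Rightarrow> real"
  assumes "linear T" "linear \<phi>"
  obtains P where "P \<noteq> 0" "\<And>k. recur P (\<lambda>n. \<phi> ((T ^^ n) v)) k = 0"
proof -
  obtain P where P: "P \<noteq> 0" "(\<Sum>i\<le>degree P. coeff P i *\<^sub>R (T ^^ i) v) = 0"
    using euclidean_sequence_dependent .
  have "linear (\<phi> \<circ> (T ^^ k))" for k
  proof -
    have "linear (T ^^ k)"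
    proof (induction k)
      case 0
      then show ?case by (simp add: linear_iff)
    next
      case (Suc k)
      then show ?case using linear_compose[OF Suc assms(1)] by (simp only: funpow.simps)
    qed
    then show ?thesis using assms(2) by (rule linear_compose)
  qed
  then have "recur P (\<lambda>n. \<phi> ((T ^^ n) v)) k
      = (\<phi> \<circ> (T ^^ k)) (\<Sum>i\<le>degree P. coeff P i *\<^sub>R (T ^^ i) v)" for k
    by (simp add: linear_sum linear_scale recur_def funpow_add del: o_apply) simp
  with P assms(2) have "recur P (\<lambda>n. \<phi> ((T ^^ n) v)) k = 0" for k
    using linear_0[OF \<open>\<And>k. linear (\<phi> \<circ> (T ^^ k))\<close>] by simp
  with P(1) that show thesis by blast
qed

section \<open>Coefficients of the LSTM process\<close>

text \<open>The coefficients are read off from the response to a unit impulse at time 0.\<close>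

lemma lstm_coefficients:
  fixes A :: "nat \<Rightarrow> real^'p^'r"
  assumes "lstm_cg_process Wzh Wch Wcx Di Df Do A"
  defines "T \<equiv> \<lambda>v. Di *v (Wch *v (Do *v v)) + Df *v v"
  shows "A n $ i $ j = (Wzh *v (Do *v (T ^^ n) (Di *v (Wcx *v axis j 1)))) $ i"
proof -
  define x :: "int \<Rightarrow> real^'p" where "x t = (if t = 0 then axis j 1 else 0)" for t
  \<comment> \<open>The impulse enters the state at time 0, after which the autonomous transition
    \<open>T\<close> acts alone.\<close>
  define c where "c t = (if t < 0 then 0 else (T ^^ nat t) (Di *v (Wcx *v axis j 1)))" for t :: int
  define h where "h t = Do *v c t" for t
  define ct where "ct t = Wch *v h (t - 1) + Wcx *v x t" for t
  have T0: "T 0 = 0" by (simp add: T_def)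
  have c_step: "c t = Di *v ct t + Df *v c (t - 1)" for t
  proof -
    have "Di *v ct t + Df *v c (t - 1) = T (c (t - 1)) + Di *v (Wcx *v x t)"
      by (simp add: ct_def h_def T_def matrix_vector_right_distrib)
    also have "\<dots> = c t"
    proof -
      consider "t < 0" | "t = 0" | "t > 0" by linarith
      then show ?thesis
      proof cases
        case 3
        then have "nat t = Suc (nat (t - 1))" by simp
        with 3 show ?thesis by (simp add: c_def x_def)
      qed (simp_all add: c_def x_def T0)
    qed
    finally show ?thesis ..
  qed
  have "\<forall>t\<ge>0. Wzh *v h t = (\<Sum>k\<le>nat t. A k *v x (t - int k)) + 0"
    using assms(1)[unfolded lstm_cg_process_def, rule_format,
        of x c "\<lambda>t. Wzh *v h t" h "\<lambda>_. 0" ct] c_step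
    by (simp add: x_def c_def h_def ct_def)
  then have "Wzh *v h (int n) = (\<Sum>k\<le>n. A k *v x (int n - int k))"
    by simp
  \<comment> \<open>Only lag n reaches back to the impulse at time 0.\<close>
  also have "\<dots> = (\<Sum>k\<le>n. if k = n then A n *v axis j 1 else 0)"
    by (intro sum.cong) (auto simp: x_def)
  also have "\<dots> = A n *v axis j 1" by simp
  finally show ?thesis
    by (simp add: h_def c_def matrix_vector_mult_basis column_def)
qed

text \<open>Each coefficient entry is a linear functional of an orbit of \<open>T\<close>, hence
  recurrent; long memory would give it power decay with exponent s = d + 1.\<close>

lemma lstm_not_long_memory:
  assumes "lstm_cg_process Wzh Wch Wcx Di Df Do A"
  shows "\<not> long_memory A"
proof
  assume "long_memory A"
  then obtain i j d C where d: "0 < d" "C \<noteq> 0"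
    and equiv: "(\<lambda>k. A k $ i $ j) \<sim>[at_top] (\<lambda>k. C * real k powr (- d - 1))"
    unfolding long_memory_def by blast
  define T where "T v = Di *v (Wch *v (Do *v v)) + Df *v v" for v
  define \<phi> where "\<phi> v = (Wzh *v (Do *v v)) $ i" for v
  have "linear T"
    unfolding T_def
    by (intro linear_compose_add matrix_vector_mul_linear
        linear_compose[OF matrix_vector_mul_linear, unfolded o_def])
  moreover have "linear \<phi>"
    unfolding \<phi>_def by (rule linearI) (simp_all add: matrix_vector_right_distrib
        matrix_vector_mult_scaleR)
  ultimately obtain P where P: "P \<noteq> 0"
      "\<And>k. recur P (\<lambda>n. \<phi> ((T ^^ n) (Di *v (Wcx *v axis j 1)))) k = 0"
    using linear_orbit_recurrent by blast
  have "(\<lambda>n. \<phi> ((T ^^ n) (Di *v (Wcx *v axis j 1)))) = (\<lambda>n. A n $ i $ j)"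
    unfolding \<phi>_def T_def using lstm_coefficients[OF assms] by simp
  with P(2) have rec: "recur P (\<lambda>n. A n $ i $ j) k = 0" for k
    by simp
  \<comment> \<open>For k > 0 the comparison sequence is nonzero, so asymptotic equivalence is
    convergence of the quotient.\<close>
  have "(\<lambda>k. A k $ i $ j / (C * real k powr (- d - 1))) \<longlonglongrightarrow> 1"
    using d by (intro asymp_equivD_strong[OF equiv] eventually_mono[OF eventually_gt_at_top[of 0]]) auto
  then have "(\<lambda>k. A k $ i $ j / (C * real k powr (- d - 1)) * C) \<longlonglongrightarrow> 1 * C"
    by (intro tendsto_mult tendsto_const)
  moreover have "- d - 1 = - (d + 1)" by simp
  ultimately have "(\<lambda>k. A k $ i $ j * real k powr (d + 1)) \<longlonglongrightarrow> C"
    using d by (simp only: powr_minus) (simp add: field_simps)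
  then show False
    using recurrent_not_powr_decay[OF rec P(1)] d by simp
qed

theorem theorem4:
  shows "(\<exists>(Wzh :: real^'q^'r) (Wch :: real^'q^'q) (Wcx :: real^'p^'q) Di Do (d :: real^'q)
            (A :: nat \<Rightarrow> real^'p^'r).
            is_diag Di \<and> is_diag Do \<and> (\<forall>i. 0 < d $ i \<and> d $ i < 1/2) \<and>
            mlstm_cg_process Wzh Wch Wcx Di d Do A \<and> long_memory A)
       \<and> (\<forall>(Wzh :: real^'q^'r) (Wch :: real^'q^'q) (Wcx :: real^'p^'q) Di Df Do
            (A :: nat \<Rightarrow> real^'p^'r).
            is_diag Di \<and> is_diag Df \<and> is_diag Do \<and>
            lstm_cg_process Wzh Wch Wcx Di Df Do A \<longrightarrow> \<not> long_memory A)"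
proof (intro conjI)
  let ?A = "\<lambda>k. (\<chi> i j. real CARD('q) * fps_nth (inverse transfer_denom) k) :: real^'p^'r"
  obtain K where K: "K \<noteq> 0"
    "(\<lambda>n. fps_nth (inverse transfer_denom) n * real n powr (4 / 3)) \<longlonglongrightarrow> K"
    by (rule inverse_transfer_denom_asymp)
  have "long_memory ?A"
  \<comment> \<open>The rate 4/3 is d + 1 for d = 1/3, which lies below 1/2.\<close>
  proof (rule long_memoryI)
    fix i j
    show "(\<lambda>n. ?A n $ i $ j * real n powr (1 / 3 + 1)) \<longlonglongrightarrow> real CARD('q) * K"
      using tendsto_mult[OF tendsto_const[of "real CARD('q)"] K(2)] by (simp add: mult.assoc)
  qed (use K in auto)
  moreover have "is_diag (mat 1 :: real^'q^'q)"
    by (simp add: is_diag_def mat_def)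
  ultimately show "\<exists>(Wzh :: real^'q^'r) (Wch :: real^'q^'q) (Wcx :: real^'p^'q) Di Do (d :: real^'q)
            (A :: nat \<Rightarrow> real^'p^'r).
            is_diag Di \<and> is_diag Do \<and> (\<forall>i. 0 < d $ i \<and> d $ i < 1/2) \<and>
            mlstm_cg_process Wzh Wch Wcx Di d Do A \<and> long_memory A"
    using mlstm_long_memory_process
    by (intro exI[of _ "\<chi> i j. 1"] exI[of _ "mat (- feedback)"] exI[of _ "mat 1"]
        exI[of _ "\<chi> i. 1 / 3"] exI[of _ ?A] conjI allI) auto
qed (use lstm_not_long_memory in blast)

end
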